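(* Let $n$ be a positive integer, $\nu>0$, and $\boldsymbol{y}\in\mathbb{R}^n_{\downarrow}$. Then $$ \mathrm{prox}_{\nu\|\cdot\|_1^{1/2}}(\boldsymbol{y})=\begin{cases} \{\boldsymbol{0}_n\}, & \text{if } \|\boldsymbol{y}\|_1\le \frac{3}{2^{4/3}}\nu^{2/3},\\ \{\boldsymbol{y}-c_n\boldsymbol{1}_n\}, & \text{if } \boldsymbol{y}\succ\frac32\nu^{2/3}\boldsymbol{1}_n,\\ \arg\min_{\boldsymbol{u}\in S_{1/2}(\boldsymbol{y})}J_{\boldsymbol{y}}(\boldsymbol{u}), & \text{if } \|\boldsymbol{y}\|_\infty>\frac32\nu^{2/3}\text{ and }\boldsymbol{y}\nsucc\frac32\nu^{2/3}\boldsymbol{1}_n,\\ \arg\min_{\boldsymbol{u}\in\{\boldsymbol{0}_n\}\cup S_{1/2}(\boldsymbol{y})}J_{\boldsymbol{y}}(\boldsymbol{u}), & \text{otherwise.} \end{cases} $$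
   Context: $[n]=\{1,\dots,n\}$. $\mathbb{R}^n_{\downarrow}=\{\boldsymbol{z}\in\mathbb{R}^n: z_1\ge\cdots\ge z_n\ge 0\}$. $\boldsymbol{0}_n,\boldsymbol{1}_n\in\mathbb{R}^n$ are the all-zeros and all-ones vectors. $\|\boldsymbol{u}\|_1=\sum_i|u_i|$, $\|\boldsymbol{u}\|_\infty=\max_i|u_i|$. For $\boldsymbol{y}\in\mathbb{R}^n_\downarrow$ and $s\in[n]$, $\|\boldsymbol{y}\|_{(s)}=\sum_{i=1}^s y_i$. $\boldsymbol{y}\succ\boldsymbol{z}$ means $y_i>z_i$ for all $i\in[n]$, and $\boldsymbol{y}\nsucc\boldsymbol{z}$ is its negation. The maximum of two vectors is componentwise. The (set-valued) proximal operator is $\mathrm{prox}_{\nu\|\cdot\|_1^{1/2}}(\boldsymbol{y})=\arg\min_{\boldsymbol{u}\in\mathbb{R}^n}J_{\boldsymbol{y}}(\boldsymbol{u})$, where $J_{\boldsymbol{y}}(\boldsymbol{u})=\nu\|\boldsymbol{u}\|_1^{1/2}+\frac12\|\boldsymbol{u}-\boldsymbol{y}\|_2^2$; $\arg\min$ denotes the set of all minimizers. For $s\in[n]$ with $\|\boldsymbol{y}\|_{(s)}\ge\frac{3}{2^{4/3}}\nu^{2/3}s^{2/3}$, put $$c_s=\frac{\sqrt3\,\nu}{4\sqrt{\|\boldsymbol{y}\|_{(s)}}\cos\left(\frac13\arccos\left(-\frac{3\sqrt3\,\nu s}{4}\|\boldsymbol{y}\|_{(s)}^{-3/2}\right)\right)}.$$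 $S_{1/2}(\boldsymbol{y})$ is the set of all vectors $\max\{\boldsymbol{y}-c_s\boldsymbol{1}_n,\boldsymbol{0}_n\}$, where $s$ ranges over those $s\in[n]$ such that $\|\boldsymbol{y}\|_{(s)}\ge\frac{3}{2^{4/3}}\nu^{2/3}s^{2/3}$, $y_s>c_s$, and $y_i\le c_s$ for all $i\in\{s+1,\dots,n\}$. *)

theory Defs
  imports "HOL-Analysis.Analysis"
begin

text \<open>
  The index set \<open>[n]\<close> is an arbitrary finite linearly ordered type \<open>'n\<close> (every such type is
  order-isomorphic to \<open>{1, \<dots>, n}\<close> with \<open>n = CARD('n) \<ge> 1\<close>). An index \<open>s\<close> is thus an element
  of \<open>'n\<close>; the natural number it stands for is its position \<open>card {..s}\<close>, and the last
  index \<open>n\<close> is \<open>Max UNIV\<close>.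
\<close>

definition pos :: "'n::{finite,linorder} \<Rightarrow> nat" where
  "pos s = card {..s}"

definition nonneg_decreasing :: "(real ^ 'n::{finite,linorder}) set" where
  "nonneg_decreasing = {z. (\<forall>i j. i \<le> j \<longrightarrow> z $ j \<le> z $ i) \<and> (\<forall>i. 0 \<le> z $ i)}"

definition norm1 :: "real ^ 'n::finite \<Rightarrow> real" where
  "norm1 u = (\<Sum>i\<in>UNIV. \<bar>u $ i\<bar>)"

definition partial_norm :: "real ^ 'n::{finite,linorder} \<Rightarrow> 'n \<Rightarrow> real" where
  "partial_norm y s = (\<Sum>i\<in>{..s}. y $ i)"

text \<open>Strict inequality in every component; the library's \<open><\<close> on vectors is weaker.\<close>

definition strictly_above :: "real ^ 'n::finite \<Rightarrow> real ^ 'n \<Rightarrow> bool"  (infix \<open>\<succ>\<close> 50) where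
  "y \<succ> z \<longleftrightarrow> (\<forall>i. y $ i > z $ i)"

definition argmin_on :: "('a \<Rightarrow> real) \<Rightarrow> 'a set \<Rightarrow> 'a set" where
  "argmin_on f A = {u. is_arg_min f (\<lambda>v. v \<in> A) u}"

definition J :: "real \<Rightarrow> real ^ 'n::finite \<Rightarrow> real ^ 'n \<Rightarrow> real" where
  "J \<nu> y u = \<nu> * norm1 u powr (1/2) + 1/2 * (norm (u - y))\<^sup>2"

definition prox :: "real \<Rightarrow> real ^ 'n::finite \<Rightarrow> (real ^ 'n) set" where
  "prox \<nu> y = argmin_on (J \<nu> y) UNIV"

definition admissible :: "real \<Rightarrow> real ^ 'n::{finite,linorder} \<Rightarrow> 'n \<Rightarrow> bool" where
  "admissible \<nu> y s \<longleftrightarrow>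
     partial_norm y s \<ge> 3 / 2 powr (4/3) * \<nu> powr (2/3) * real (pos s) powr (2/3)"

text \<open>The value is meaningful only for admissible \<open>s\<close>: then the argument of \<open>arccos\<close> lies
  in \<open>[-1, 0]\<close>.\<close>

definition c :: "real \<Rightarrow> real ^ 'n::{finite,linorder} \<Rightarrow> 'n \<Rightarrow> real" where
  "c \<nu> y s =
     sqrt 3 * \<nu> /
       (4 * sqrt (partial_norm y s) *
        cos (1/3 * arccos (- (3 * sqrt 3 * \<nu> * real (pos s) / 4 * partial_norm y s powr (-3/2)))))"

definition S_half :: "real \<Rightarrow> real ^ 'n::{finite,linorder} \<Rightarrow> (real ^ 'n::{finite,linorder}) set" where
  "S_half \<nu> y =
     {(\<chi> i. max (y $ i - c \<nu> y s) 0) | s.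
        admissible \<nu> y s \<and> y $ s > c \<nu> y s \<and> (\<forall>i>s. y $ i \<le> c \<nu> y s)}"

end

theory Submission
  imports Defs
begin

text \<open>
  The objective is coercive and continuous, so a minimizer \<open>u\<close> exists, and it is nonnegative
  because \<open>y\<close> is. What remains is to extract enough necessary conditions to pin \<open>u\<close> down.

  Let \<open>u \<noteq> 0\<close>, \<open>x = sqrt (norm1 u)\<close> and \<open>\<gamma> = \<nu> / (2 * x)\<close>, the rate at which the penalty grows
  with each coordinate. Moving a single coordinate up or down gives \<open>u\<^sub>i = max (y\<^sub>i - \<gamma>) 0\<close>. As \<open>y\<close> is decreasing,
  the support is an initial segment \<open>{..s}\<close>, and summing over it shows that \<open>x\<close> is a root of the cubic
  \<open>x\<^sup>3 - Y * x + p * \<nu> / 2\<close>, where \<open>Y = partial_norm y s\<close> and \<open>p = pos s\<close>. The cubic has in general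
  two positive roots. The choice between them is a second-order question: moving all coordinates
  of the support upwards together shows \<open>p * \<nu> \<le> 4 * x\<^sup>3\<close>, which singles out the larger root. Viete's
  trigonometric formula for that root turns \<open>\<gamma>\<close> into \<open>c \<nu> y s\<close>, and the inequality between
  arithmetic and geometric means, applied to the cubic, is the admissibility of \<open>s\<close>
  (\<open>prox_subset_S_half\<close>).

  The case distinction only decides whether \<open>0\<close>, or a partial support, can occur. Put
  \<open>\<kappa> = \<nu> powr (1/3)\<close>. Everything rests on
  \<open>2 * \<kappa>\<^sup>3 + m\<^sup>3 - 3 * \<kappa>\<^sup>2 * m = (m - \<kappa>)\<^sup>2 * (m + 2 * \<kappa>)\<close>, whose double root \<open>m = \<kappa>\<close> is the point at which a
  one-dimensional jump away from \<open>0\<close> first breaks even. It shows that \<open>0\<close> is the only minimizer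
  if \<open>norm1 y < 3/2 * \<kappa>\<^sup>2\<close> (\<open>prox_eq_zero\<close>), and not one if some \<open>y\<^sub>i\<close> exceeds \<open>3/2 * \<kappa>\<^sup>2\<close>; in that event
  the second-order bound moreover forces \<open>u\<^sub>i > 0\<close> (\<open>prox_coordinate_pos\<close>). If all \<open>y\<^sub>i\<close> are that large,
  the support is everything, and \<open>u\<close> is determined. In the other cases all minimizers lie in the
  stated candidate set, so minimizing over that set is the same as minimizing globally.
\<close>

section \<open>Minimizers\<close>

lemma prox_iff: "u \<in> prox \<nu> y \<longleftrightarrow> (\<forall>v. J \<nu> y u \<le> J \<nu> y v)"
  by (auto simp: prox_def argmin_on_def is_arg_min_def not_less)

lemma J_eq: "J \<nu> y u = \<nu> * sqrt (norm1 u) + (\<Sum>i\<in>UNIV. (u $ i - y $ i)\<^sup>2) / 2"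
proof -
  have "(norm (u - y))\<^sup>2 = (\<Sum>i\<in>UNIV. (u $ i - y $ i)\<^sup>2)"
    by (simp add: power2_norm_eq_inner inner_vec_def flip: power2_eq_square)
  moreover have "norm1 u \<ge> 0" by (simp add: norm1_def sum_nonneg)
  ultimately show ?thesis by (simp add: J_def powr_half_sqrt)
qed

lemma prox_nonempty:
  fixes \<nu> :: real and y :: "real ^ 'n::finite"
  assumes "\<nu> \<ge> 0"
  shows "prox \<nu> y \<noteq> {}"
proof -
  have cont: "continuous_on UNIV (J \<nu> y)"
    unfolding J_eq[abs_def] norm1_def by (intro continuous_intros) auto
  let ?L = "{u. J \<nu> y u \<le> J \<nu> y y}"
  have "closed ?L" using cont by (intro closed_Collect_le) auto
  moreover have "?L \<subseteq> cball y (sqrt (2 * J \<nu> y y))"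
  proof
    fix u assume "u \<in> ?L"
    moreover have "0 \<le> \<nu> * norm1 u powr (1/2)" using assms by simp
    ultimately have "(norm (u - y))\<^sup>2 \<le> 2 * J \<nu> y y" by (simp add: J_def)
    then show "u \<in> cball y (sqrt (2 * J \<nu> y y))"
      by (simp add: dist_norm norm_minus_commute real_le_rsqrt)
  qed
  ultimately have "compact ?L"
    using bounded_subset[OF bounded_cball] compact_eq_bounded_closed by blast
  moreover have "y \<in> ?L" by simp
  ultimately obtain u where u: "u \<in> ?L" "\<And>v. v \<in> ?L \<Longrightarrow> J \<nu> y u \<le> J \<nu> y v"
    using continuous_attains_inf[of ?L "J \<nu> y"] cont continuous_on_subset by blast
  have "u \<in> prox \<nu> y"
    unfolding prox_iff using u by (smt (verit) mem_Collect_eq)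
  then show ?thesis by blast
qed

lemma argmin_on_eq_prox:
  assumes "prox \<nu> y \<subseteq> A" "prox \<nu> y \<noteq> {}"
  shows "argmin_on (J \<nu> y) A = prox \<nu> y"
proof -
  obtain u where u: "u \<in> prox \<nu> y" using assms(2) by blast
  have "v \<in> prox \<nu> y" if "v \<in> argmin_on (J \<nu> y) A" for v
  proof -
    have "J \<nu> y v \<le> J \<nu> y u"
      using that u assms(1) by (force simp: argmin_on_def is_arg_min_def)
    then show ?thesis using u order_trans unfolding prox_iff by blast
  qed
  moreover have "v \<in> argmin_on (J \<nu> y) A" if "v \<in> prox \<nu> y" for v
    using that assms(1) by (auto simp: argmin_on_def is_arg_min_def prox_iff not_less)
  ultimately show ?thesis by blast
qed

text \<open>Replacing the negative entries by \<open>0\<close> brings both terms of the objective down.\<close>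

lemma prox_nonneg:
  fixes \<nu> :: real and y :: "real ^ 'n::finite"
  assumes "\<nu> \<ge> 0" "\<And>i. 0 \<le> y $ i" "u \<in> prox \<nu> y"
  shows "0 \<le> u $ i"
proof (rule ccontr)
  assume neg: "\<not> 0 \<le> u $ i"
  define v :: "real ^ 'n" where "v = (\<chi> i. max (u $ i) 0)"
  have "norm1 v \<le> norm1 u"
    unfolding norm1_def v_def by (intro sum_mono) auto
  then have "\<nu> * sqrt (norm1 v) \<le> \<nu> * sqrt (norm1 u)"
    using assms(1) by (intro mult_left_mono) auto
  moreover have "(\<Sum>j\<in>UNIV. (v $ j - y $ j)\<^sup>2) < (\<Sum>j\<in>UNIV. (u $ j - y $ j)\<^sup>2)"
  proof (rule sum_strict_mono_ex1)
    have le: "(v $ j - y $ j)\<^sup>2 \<le> (u $ j - y $ j)\<^sup>2" for j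
      using assms(2)[of j] by (auto simp: v_def max_def abs_le_square_iff[symmetric])
    then show "\<forall>j\<in>UNIV. (v $ j - y $ j)\<^sup>2 \<le> (u $ j - y $ j)\<^sup>2" by blast
    have "\<bar>v $ i - y $ i\<bar> < \<bar>u $ i - y $ i\<bar>"
      using neg assms(2)[of i] by (simp add: v_def)
    then show "\<exists>j\<in>UNIV. (v $ j - y $ j)\<^sup>2 < (u $ j - y $ j)\<^sup>2"
      by (metis UNIV_I abs_le_square_iff not_less)
  qed simp
  ultimately have "J \<nu> y v < J \<nu> y u" by (simp add: J_eq)
  then show False using assms(3) by (auto simp: prox_iff not_less[symmetric])
qed

text \<open>
  A singleton \<open>B\<close> yields the first-order conditions and the escape from \<open>0\<close>; the support of \<open>u\<close> as \<open>B\<close>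
  yields the second-order condition.
\<close>

lemma J_shift:
  fixes \<nu> :: real and y u :: "real ^ 'n::finite" and B :: "'n set" and t :: real
  assumes u: "\<And>i. 0 \<le> u $ i" and v: "\<And>i. i \<in> B \<Longrightarrow> 0 \<le> u $ i + t"
  shows "J \<nu> y (\<chi> i. u $ i + (if i \<in> B then t else 0)) - J \<nu> y u =
    \<nu> * (sqrt (norm1 u + card B * t) - sqrt (norm1 u))
      + t * (\<Sum>i\<in>B. u $ i - y $ i) + card B * t\<^sup>2 / 2" (is "J \<nu> y ?v - _ = _")
proof -
  have restrict: "(\<Sum>i\<in>UNIV. if i \<in> B then f i else 0) = sum f B" for f :: "'n \<Rightarrow> real"
    by (simp add: sum.If_cases)
  have "norm1 ?v = (\<Sum>i\<in>UNIV. u $ i + (if i \<in> B then t else 0))"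
    unfolding norm1_def using u v by (intro sum.cong) auto
  also have "\<dots> = norm1 u + card B * t"
    using u by (simp add: sum.distrib restrict norm1_def)
  finally have n1: "norm1 ?v = norm1 u + card B * t" .
  have "(\<Sum>i\<in>UNIV. (?v $ i - y $ i)\<^sup>2)
      = (\<Sum>i\<in>UNIV. (u $ i - y $ i)\<^sup>2 + (if i \<in> B then 2 * t * (u $ i - y $ i) + t\<^sup>2 else 0))"
    by (intro sum.cong) (auto simp: power2_eq_square algebra_simps)
  also have "\<dots> = (\<Sum>i\<in>UNIV. (u $ i - y $ i)\<^sup>2)
      + (2 * t * (\<Sum>i\<in>B. u $ i - y $ i) + card B * t\<^sup>2)"
    by (simp add: sum.distrib restrict flip: sum_distrib_left)
  finally show ?thesis
    unfolding J_eq n1 by (simp add: algebra_simps)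
qed

section \<open>Necessary conditions at a nonzero minimizer\<close>

lemma norm1_pos: "u \<noteq> 0 \<Longrightarrow> 0 < norm1 u" for u :: "real ^ 'n::finite"
  by (auto simp: norm1_def vec_eq_iff sum_nonneg_eq_0_iff order_less_le sum_nonneg)

lemma prox_first_order:
  fixes \<nu> :: real and y u :: "real ^ 'n::finite"
  assumes "\<nu> \<ge> 0" and y: "\<And>i. 0 \<le> y $ i" and u: "u \<in> prox \<nu> y" "u \<noteq> 0"
  shows "u $ i = max (y $ i - \<nu> / (2 * sqrt (norm1 u))) 0"
proof -
  have nn: "\<And>i. 0 \<le> u $ i" using prox_nonneg assms by blast
  define T where "T = norm1 u"
  have T: "T > 0" using norm1_pos u T_def by blast
  define g where "g t = \<nu> * sqrt (T + t) + t * (u $ i - y $ i) + t\<^sup>2 / 2" for t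
  define D where "D = \<nu> / (2 * sqrt T) + (u $ i - y $ i)"
  have deriv: "(g has_real_derivative D) (at 0)"
    unfolding g_def D_def using T by (auto intro!: derivative_eq_intros simp: field_simps)
  have min: "g 0 \<le> g t" if "0 \<le> u $ i + t" for t
  proof -
    have "J \<nu> y u \<le> J \<nu> y (\<chi> j. u $ j + (if j \<in> {i} then t else 0))"
      using u(1) prox_iff by blast
    then show ?thesis
      using J_shift[of u "{i}" t \<nu> y] nn that by (simp add: g_def T_def algebra_simps)
  qed
  have "D \<ge> 0"
  proof (rule ccontr)
    assume "\<not> D \<ge> 0"
    then obtain d where d: "d > 0" "\<And>h. 0 < h \<Longrightarrow> h < d \<Longrightarrow> g (0 + h) < g 0"
      using DERIV_neg_dec_right[OF deriv] by force
    have "g (d/2) < g 0" using d(2)[of "d/2"] d(1) by simp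
    then show False using min[of "d/2"] nn[of i] d(1) by simp
  qed
  moreover have "D \<le> 0" if "u $ i > 0"
  proof (rule ccontr)
    assume "\<not> D \<le> 0"
    then obtain d where d: "d > 0" "\<And>h. 0 < h \<Longrightarrow> h < d \<Longrightarrow> g (0 - h) < g 0"
      using DERIV_pos_inc_left[OF deriv] by force
    define h where "h = min (d/2) (u $ i)"
    have "0 < h" "h < d" "h \<le> u $ i" using d(1) that by (auto simp: h_def)
    then show False using d(2)[of h] min[of "- h"] by simp
  qed
  ultimately show ?thesis
    using nn[of i] by (cases "u $ i = 0") (auto simp: D_def T_def max_def)
qed

text \<open>
  Shift the whole support by \<open>t \<ge> 0\<close> and write \<open>z\<^sup>2\<close> for the new \<open>norm1\<close>. By the first-order
  conditions, the objective changes by exactly \<open>(z - x)\<^sup>2 * ((z + x)\<^sup>2 / p - \<nu> / x) / 2\<close>, so the second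
  factor must be nonnegative for all \<open>z > x\<close>; the claim is its limit for \<open>z \<rightarrow> x\<close>.
\<close>

lemma prox_second_order:
  fixes \<nu> :: real and y u :: "real ^ 'n::finite"
  assumes "\<nu> \<ge> 0" and y: "\<And>i. 0 \<le> y $ i" and u: "u \<in> prox \<nu> y" "u \<noteq> 0"
  shows "card {i. u $ i > 0} * \<nu> \<le> 4 * sqrt (norm1 u) ^ 3"
proof (rule ccontr)
  assume less: "\<not> ?thesis"
  have nn: "\<And>i. 0 \<le> u $ i" using prox_nonneg assms by blast
  define B where "B = {i. u $ i > 0}"
  define p where "p = real (card B)"
  define x where "x = sqrt (norm1 u)"
  have x: "x > 0" using norm1_pos u x_def by simp
  have x2: "norm1 u = x\<^sup>2" using norm1_pos[OF u(2)] by (simp add: x_def)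
  have p: "p > 0"
  proof -
    have "B \<noteq> {}" using u(2) nn by (force simp: B_def vec_eq_iff order_less_le)
    then show ?thesis by (simp add: p_def card_gt_0_iff)
  qed
  have "((\<lambda>z. (z + x)\<^sup>2 * x) \<longlongrightarrow> (x + x)\<^sup>2 * x) (at_right x)"
    by (intro tendsto_intros)
  moreover have "(x + x)\<^sup>2 * x < p * \<nu>"
    using less by (simp add: p_def B_def x_def power2_eq_square power3_eq_cube)
  ultimately have "eventually (\<lambda>z. (z + x)\<^sup>2 * x < p * \<nu>) (at_right x)"
    by (rule order_tendstoD)
  then obtain z where z: "z > x" "(z + x)\<^sup>2 * x < p * \<nu>"
    unfolding eventually_at_right_field by (meson dense)
  define t where "t = (z\<^sup>2 - x\<^sup>2) / p"
  have t: "p * t = z\<^sup>2 - x\<^sup>2" "t \<ge> 0"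
    using p z x by (auto simp: t_def intro!: power_mono divide_nonneg_pos)
  have "(\<Sum>i\<in>B. u $ i - y $ i) = (\<Sum>i\<in>B. - \<nu> / (2 * x))"
    using prox_first_order[OF assms]
    by (intro sum.cong) (auto simp: B_def x_def max_def split: if_splits)
  then have grad: "(\<Sum>i\<in>B. u $ i - y $ i) = - p * \<nu> / (2 * x)" by (simp add: p_def)
  have "0 \<le> J \<nu> y (\<chi> i. u $ i + (if i \<in> B then t else 0)) - J \<nu> y u"
    using u(1) by (simp add: prox_iff)
  also have "\<dots> = \<nu> * (sqrt (x\<^sup>2 + p * t) - sqrt (x\<^sup>2)) + t * (- p * \<nu> / (2 * x)) + p * t\<^sup>2 / 2"
    using J_shift[of u B t \<nu> y] nn t(2) by (simp add: grad x2 p_def)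
  also have "\<dots> = \<nu> * (sqrt (x\<^sup>2 + p * t) - sqrt (x\<^sup>2)) - (p * t) * \<nu> / (2 * x) + (p * t)\<^sup>2 / (2 * p)"
    using p by (simp add: power2_eq_square ac_simps)
  also have "\<dots> = \<nu> * (z - x) - (z\<^sup>2 - x\<^sup>2) * \<nu> / (2 * x) + (z\<^sup>2 - x\<^sup>2)\<^sup>2 / (2 * p)"
    unfolding t(1) using x z(1) by simp
  also have "\<dots> = (z - x)\<^sup>2 * ((z + x)\<^sup>2 * x - p * \<nu>) / (2 * p * x)"
    using x p by (simp add: field_simps power2_eq_square)
  also have "\<dots> < 0"
    using x z p by (intro divide_neg_pos mult_pos_neg) auto
  finally show False by simp
qed

section \<open>Viete's formula for the larger root\<close>

text \<open>
  With \<open>r = 2 * sqrt (Y / 3)\<close>, the cubic becomes the triple angle formula for \<open>cos \<theta> = x / r\<close>.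
  The condition \<open>q \<le> 4 * x\<^sup>3\<close> is equivalent to \<open>x / r \<ge> 1/2\<close>; hence \<open>3 * \<theta>\<close> lies in \<open>[0, pi]\<close>, and \<open>arccos\<close>
  recovers it.
\<close>

lemma larger_root_eq_cos:
  fixes x Y q :: real
  assumes x: "x > 0" and q: "0 \<le> q" "q \<le> 4 * x ^ 3" and root: "x ^ 3 - Y * x + q / 2 = 0"
  shows "Y > 0"
    and "cos (1/3 * arccos (- (3 * sqrt 3 * q / 4 * Y powr (-3/2)))) = sqrt 3 * x / (2 * sqrt Y)"
proof -
  have Y: "Y = x\<^sup>2 + q / (2 * x)"
    using root x by (simp add: field_simps power2_eq_square power3_eq_cube)
  have "q / (2 * x) \<le> 2 * x\<^sup>2"
    using q x by (simp add: field_simps power2_eq_square power3_eq_cube)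
  with Y have Yu: "Y \<le> 3 * x\<^sup>2" by simp
  have Yl: "x\<^sup>2 \<le> Y" using Y q x by simp
  show Y0: "Y > 0" using Yl x by (smt (verit) zero_less_power)
  define w where "w = sqrt Y"
  have w: "w > 0" "w\<^sup>2 = Y" using Y0 by (auto simp: w_def)
  define k where "k = sqrt 3 * x / (2 * w)"
  have k0: "k > 0" using x w by (simp add: k_def)
  have k2: "k\<^sup>2 = 3 * x\<^sup>2 / (4 * Y)"
    by (simp add: k_def power_divide power_mult_distrib w(2))
  have "(1/2)\<^sup>2 \<le> k\<^sup>2" "k\<^sup>2 \<le> 1\<^sup>2"
    unfolding k2 using Yu Yl Y0 by (auto simp: field_simps power2_eq_square)
  then have k: "1/2 \<le> k" "k \<le> 1"
    using k0 power2_le_imp_le[of "1/2" k] power2_le_imp_le[of k 1] by auto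
  define \<theta> where "\<theta> = arccos k"
  have cos\<theta>: "cos \<theta> = k" using k by (simp add: \<theta>_def)
  have "\<theta> \<le> pi / 3"
    using arccos_le_mono[of k "1/2"] k arccos_cos[of "pi/3"] by (simp add: \<theta>_def cos_60)
  moreover have "0 \<le> \<theta>" using k by (simp add: \<theta>_def arccos_lbound)
  ultimately have "arccos (cos (3 * \<theta>)) = 3 * \<theta>" by (intro arccos_cos) auto
  moreover have "cos (3 * \<theta>) = - (3 * sqrt 3 * q / 4 * Y powr (-3/2))"
  proof -
    have "Y powr (-3/2) = 1 / w ^ 3"
    proof -
      have "Y powr (3/2) = (Y powr (1/2)) powr 3" by (simp add: powr_powr)
      also have "\<dots> = w ^ 3" using w Y0 by (simp add: powr_half_sqrt w_def)
      finally show ?thesis by (simp add: powr_minus_divide)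
    qed
    moreover have "4 * k ^ 3 - 3 * k = - (3 * sqrt 3 * q / (4 * w ^ 3))"
    proof -
      have q_eq: "q = 2 * w\<^sup>2 * x - 2 * x ^ 3" using root w by (simp add: algebra_simps)
      have "k ^ 3 = k * k\<^sup>2" by (simp add: power3_eq_cube power2_eq_square)
      also have "\<dots> = 3 * sqrt 3 * x ^ 3 / (8 * w ^ 3)"
        unfolding k2 w(2)[symmetric] by (simp add: k_def power3_eq_cube power2_eq_square)
      finally have "k ^ 3 = 3 * sqrt 3 * x ^ 3 / (8 * w ^ 3)" .
      then show ?thesis
        unfolding q_eq using w(1) by (simp add: k_def field_simps power3_eq_cube power2_eq_square)
    qed
    ultimately show ?thesis by (simp add: cos_treble_cos cos\<theta>)
  qed
  ultimately show "cos (1/3 * arccos (- (3 * sqrt 3 * q / 4 * Y powr (-3/2)))) = sqrt 3 * x / (2 * sqrt Y)"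
    using cos\<theta> by (simp add: k_def w_def)
qed

lemma powr_third_cube: "0 < a \<Longrightarrow> (a powr (1/3)) ^ 3 = a" for a :: real
  by (simp add: powr_powr flip: powr_numeral)

lemma powr_third_square: "0 < a \<Longrightarrow> (a powr (1/3))\<^sup>2 = a powr (2/3)" for a :: real
  by (simp add: powr_powr flip: powr_numeral)

text \<open>
  The inequality of means \<open>x\<^sup>3 + 2 * k\<^sup>3 \<ge> 3 * k\<^sup>2 * x\<close> with \<open>k\<^sup>3 = \<nu> * p / 4\<close>: the admissibility
  threshold is the minimum of \<open>x\<^sup>2 + p * \<nu> / (2 * x)\<close> over \<open>x > 0\<close>.
\<close>

lemma cubic_root_imp_threshold:
  fixes x Y \<nu> p :: real
  assumes "x > 0" "\<nu> > 0" "p > 0" and root: "x ^ 3 - Y * x + p * \<nu> / 2 = 0"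
  shows "3 / 2 powr (4/3) * \<nu> powr (2/3) * p powr (2/3) \<le> Y"
proof -
  define k where "k = (\<nu> * p / 4) powr (1/3)"
  have k: "k \<ge> 0" "k ^ 3 = \<nu> * p / 4" "k\<^sup>2 = (\<nu> * p / 4) powr (2/3)"
    using assms by (auto simp: k_def powr_third_cube powr_third_square)
  have "(4::real) powr (2/3) = (2 powr 2) powr (2/3)" by simp
  also have "\<dots> = 2 powr (4/3)" by (simp only: powr_powr) simp
  finally have "3 / 2 powr (4/3) * \<nu> powr (2/3) * p powr (2/3) = 3 * k\<^sup>2"
    using assms by (simp add: k(3) powr_divide powr_mult)
  moreover have "0 \<le> (x - k)\<^sup>2 * (x + 2 * k)"
    using assms k by (intro mult_nonneg_nonneg) auto
  then have "3 * k\<^sup>2 * x \<le> x ^ 3 + 2 * k ^ 3"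
    by (simp add: power2_eq_square power3_eq_cube algebra_simps)
  then have "3 * k\<^sup>2 * x \<le> Y * x" using root k(2) by (simp add: mult.commute)
  ultimately show ?thesis using assms(1) by simp
qed

section \<open>Locating the minimizers\<close>

text \<open>
  Besides membership of \<open>u\<close> in \<open>S_half\<close>, the support is kept: where it is known to be everything, \<open>s\<close>
  must be the last index.
\<close>

lemma prox_imp_S_half_form:
  fixes \<nu> :: real and y u :: "real ^ 'n::{finite,linorder}"
  assumes \<nu>: "\<nu> > 0" and y: "y \<in> nonneg_decreasing" and u: "u \<in> prox \<nu> y" "u \<noteq> 0"
  obtains s where "{i. u $ i > 0} = {..s}" "admissible \<nu> y s"
    "\<And>i. u $ i = max (y $ i - c \<nu> y s) 0"
proof -
  have y0: "\<And>i. 0 \<le> y $ i" and ymono: "\<And>i j. i \<le> j \<Longrightarrow> y $ j \<le> y $ i"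
    using y by (auto simp: nonneg_decreasing_def)
  have nn: "\<And>i. 0 \<le> u $ i" using prox_nonneg[OF _ y0 u(1)] \<nu> by simp
  define x where "x = sqrt (norm1 u)"
  have x: "x > 0" "x\<^sup>2 = norm1 u" using norm1_pos[OF u(2)] by (auto simp: x_def)
  have first: "u $ i = max (y $ i - \<nu> / (2 * x)) 0" for i
    using prox_first_order[OF _ y0 u] \<nu> by (simp add: x_def)
  define B where "B = {i. u $ i > 0}"
  have "B \<noteq> {}" using u(2) nn by (force simp: B_def vec_eq_iff order_less_le)
  define s where "s = Max B"
  have "s \<in> B" using \<open>B \<noteq> {}\<close> by (simp add: s_def)
  have B: "B = {..s}"
  proof
    show "B \<subseteq> {..s}" by (auto simp: s_def)
    show "{..s} \<subseteq> B"
      using \<open>s \<in> B\<close> ymono[of _ s] by (auto simp: B_def first) (smt (verit))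
  qed
  define p where "p = real (pos s)"
  define Y where "Y = partial_norm y s"
  have p: "p = card B" "p > 0" using B by (auto simp: p_def pos_def card_gt_0_iff)
  have "norm1 u = sum (($) u) B"
    unfolding norm1_def using nn
    by (intro sum.mono_neutral_cong_right) (auto simp: B_def order_less_le)
  also have "\<dots> = (\<Sum>i\<in>B. y $ i - \<nu> / (2 * x))"
    by (intro sum.cong refl) (use first in \<open>auto simp: B_def max_def split: if_splits\<close>)
  also have "\<dots> = Y - p * (\<nu> / (2 * x))"
    by (simp add: sum_subtractf p Y_def partial_norm_def B)
  finally have "x\<^sup>2 = Y - p * (\<nu> / (2 * x))" using x by simp
  then have "x * x\<^sup>2 = x * (Y - p * (\<nu> / (2 * x)))" by simp
  then have root: "x ^ 3 - Y * x + p * \<nu> / 2 = 0"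
    using x by (simp add: power2_eq_square power3_eq_cube algebra_simps)
  have large: "p * \<nu> \<le> 4 * x ^ 3"
    using prox_second_order[OF _ y0 u] \<nu> by (simp add: p B_def x_def)
  have adm: "admissible \<nu> y s"
    unfolding admissible_def using cubic_root_imp_threshold[OF x(1) \<nu> p(2) root]
    by (simp add: Y_def p_def)
  note viete = larger_root_eq_cos[OF x(1) _ large root]
  have Y: "Y > 0" using viete(1) p \<nu> by simp
  have "cos (1/3 * arccos (- (3 * sqrt 3 * \<nu> * p / 4 * Y powr (-3/2)))) = sqrt 3 * x / (2 * sqrt Y)"
    using viete(2) p(2) \<nu> by (simp add: mult_ac)
  then have "c \<nu> y s = sqrt 3 * \<nu> / (4 * sqrt Y * (sqrt 3 * x / (2 * sqrt Y)))"
    unfolding c_def Y_def[symmetric] p_def[symmetric] by simp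
  also have "\<dots> = \<nu> / (2 * x)" using Y x by (simp add: field_simps)
  finally have "\<And>i. u $ i = max (y $ i - c \<nu> y s) 0" using first by simp
  with that B adm show ?thesis unfolding B_def by blast
qed

lemma prox_subset_S_half:
  fixes \<nu> :: real and y :: "real ^ 'n::{finite,linorder}"
  assumes "\<nu> > 0" "y \<in> nonneg_decreasing"
  shows "prox \<nu> y \<subseteq> {0} \<union> S_half \<nu> y"
proof
  fix u assume u: "u \<in> prox \<nu> y"
  show "u \<in> {0} \<union> S_half \<nu> y"
  proof (cases "u = 0")
    case False
    obtain s where s: "{i. u $ i > 0} = {..s}" "admissible \<nu> y s"
      "\<And>i. u $ i = max (y $ i - c \<nu> y s) 0"
      using prox_imp_S_half_form[OF assms u False] by blast
    have supp: "c \<nu> y s < y $ i \<longleftrightarrow> i \<le> s" for i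
    proof -
      have "i \<le> s \<longleftrightarrow> 0 < u $ i" using s(1) by blast
      also have "\<dots> \<longleftrightarrow> c \<nu> y s < y $ i" unfolding s(3) by auto
      finally show ?thesis ..
    qed
    have "u = (\<chi> i. max (y $ i - c \<nu> y s) 0)" using s(3) by (simp add: vec_eq_iff)
    moreover have "c \<nu> y s < y $ s" "\<forall>i>s. y $ i \<le> c \<nu> y s"
      using supp by (auto simp flip: not_less)
    ultimately show ?thesis using s(2) unfolding S_half_def by blast
  qed auto
qed

text \<open>
  Let \<open>m\<^sup>2\<close> be the largest \<open>\<bar>u\<^sub>i\<bar>\<close>. From \<open>0\<close> to \<open>u\<close> the objective rises by
  \<open>\<nu> * sqrt (norm1 u) + (norm u)\<^sup>2 / 2 - u \<bullet> y\<close>. Dropping all but the largest entry in the first two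
  terms and Hoelder's inequality in the third bound this below by
  \<open>\<nu> * m + m\<^sup>4 / 2 - m\<^sup>2 * norm1 y\<close>.
\<close>

lemma prox_eq_zero:
  fixes \<nu> :: real and y :: "real ^ 'n::finite"
  assumes \<nu>: "\<nu> > 0" and small: "norm1 y < 3/2 * \<nu> powr (2/3)"
  shows "prox \<nu> y = {0}"
proof -
  have zero: "u = 0" if u: "u \<in> prox \<nu> y" for u
  proof (rule ccontr)
    assume "u \<noteq> 0"
    define \<kappa> where "\<kappa> = \<nu> powr (1/3)"
    have \<kappa>: "\<kappa> > 0" "\<nu> = \<kappa> ^ 3" "\<nu> powr (2/3) = \<kappa>\<^sup>2"
      using \<nu> by (auto simp: \<kappa>_def powr_third_cube powr_third_square)
    define M where "M = Max (range (\<lambda>i. \<bar>u $ i\<bar>))"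
    have M: "\<bar>u $ i\<bar> \<le> M" for i by (simp add: M_def)
    have "M \<in> range (\<lambda>i. \<bar>u $ i\<bar>)" unfolding M_def by (intro Max_in) auto
    then obtain j where j: "M = \<bar>u $ j\<bar>" by blast
    obtain l where "u $ l \<noteq> 0" using \<open>u \<noteq> 0\<close> by (auto simp: vec_eq_iff)
    then have "M > 0" using M[of l] by linarith
    define m where "m = sqrt M"
    have m: "m > 0" "m\<^sup>2 = M" using \<open>M > 0\<close> by (auto simp: m_def)
    have "M \<le> norm1 u"
      unfolding norm1_def j by (rule member_le_sum) auto
    then have 1: "\<nu> * m \<le> \<nu> * sqrt (norm1 u)" using \<nu> by (simp add: m_def)
    have "(u $ j)\<^sup>2 \<le> (\<Sum>i\<in>UNIV. (u $ i)\<^sup>2)" by (rule member_le_sum) auto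
    then have 2: "M\<^sup>2 \<le> (\<Sum>i\<in>UNIV. (u $ i)\<^sup>2)" by (simp add: j)
    have "(\<Sum>i\<in>UNIV. u $ i * y $ i) \<le> (\<Sum>i\<in>UNIV. M * \<bar>y $ i\<bar>)"
    proof (rule sum_mono)
      fix i show "u $ i * y $ i \<le> M * \<bar>y $ i\<bar>"
        using M[of i] abs_ge_self[of "u $ i * y $ i"] mult_right_mono[of "\<bar>u $ i\<bar>" M "\<bar>y $ i\<bar>"]
        by (simp add: abs_mult)
    qed
    then have 3: "(\<Sum>i\<in>UNIV. u $ i * y $ i) \<le> M * norm1 y"
      by (simp add: norm1_def sum_distrib_left)
    have "J \<nu> y u - J \<nu> y 0
        = \<nu> * sqrt (norm1 u) + (\<Sum>i\<in>UNIV. (u $ i)\<^sup>2) / 2 - (\<Sum>i\<in>UNIV. u $ i * y $ i)"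
      by (simp add: J_eq norm1_def power2_diff sum.distrib sum_subtractf sum_distrib_left[symmetric]
          mult.assoc diff_divide_distrib add_divide_distrib)
    moreover have "0 \<le> m * ((m - \<kappa>)\<^sup>2 * (m + 2 * \<kappa>)) / 2"
      using m \<kappa> by (intro divide_nonneg_pos mult_nonneg_nonneg) auto
    then have "0 \<le> \<nu> * m + M\<^sup>2 / 2 - M * (3/2 * \<kappa>\<^sup>2)"
      unfolding m(2)[symmetric] \<kappa>(2)
      by (simp add: power2_eq_square power3_eq_cube field_simps)
    moreover have "M * norm1 y < M * (3/2 * \<kappa>\<^sup>2)"
      using small \<open>M > 0\<close> \<kappa>(3) by (intro mult_strict_left_mono) auto
    ultimately have "J \<nu> y 0 < J \<nu> y u" using 1 2 3 by linarith
    then show False using u by (auto simp: prox_iff not_less[symmetric])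
  qed
  moreover have "prox \<nu> y \<noteq> {}" using prox_nonempty[of \<nu>] \<nu> by simp
  ultimately show ?thesis by blast
qed

text \<open>
  The step from \<open>0\<close> to \<open>\<kappa>\<^sup>2\<close> in coordinate \<open>i\<close> alone already pays off, so \<open>u \<noteq> 0\<close>. Then
  \<open>\<nu> \<le> 4 * x\<^sup>3\<close> makes \<open>x\<close> at least \<open>\<kappa> / 2\<close>, and so the shrinkage \<open>\<nu> / (2 * x)\<close> is at most \<open>\<kappa>\<^sup>2\<close>.
\<close>

lemma prox_coordinate_pos:
  fixes \<nu> :: real and y u :: "real ^ 'n::finite"
  assumes \<nu>: "\<nu> > 0" and y: "\<And>i. 0 \<le> y $ i" and u: "u \<in> prox \<nu> y"
    and large: "y $ i > 3/2 * \<nu> powr (2/3)"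
  shows "u $ i > 0"
proof -
  define \<kappa> where "\<kappa> = \<nu> powr (1/3)"
  have \<kappa>: "\<kappa> > 0" "\<nu> = \<kappa> ^ 3" "\<nu> powr (2/3) = \<kappa>\<^sup>2"
    using \<nu> by (auto simp: \<kappa>_def powr_third_cube powr_third_square)
  have "u \<noteq> 0"
  proof
    assume "u = 0"
    then have "0 \<le> J \<nu> y (\<chi> j. 0 $ j + (if j \<in> {i} then \<kappa>\<^sup>2 else 0)) - J \<nu> y 0"
      using u by (simp add: prox_iff)
    also have "\<dots> = \<nu> * \<kappa> - \<kappa>\<^sup>2 * y $ i + (\<kappa>\<^sup>2)\<^sup>2 / 2"
      using J_shift[of 0 "{i}" "\<kappa>\<^sup>2" \<nu> y] \<kappa>(1) by (simp add: norm1_def)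
    also have "\<dots> = \<kappa>\<^sup>2 * (3/2 * \<kappa>\<^sup>2 - y $ i)"
      unfolding \<kappa>(2) by (simp add: power2_eq_square power3_eq_cube algebra_simps)
    also have "\<dots> < 0" using large \<kappa> by (intro mult_pos_neg) auto
    finally show False by simp
  qed
  define x where "x = sqrt (norm1 u)"
  have x: "x > 0" using norm1_pos[OF \<open>u \<noteq> 0\<close>] by (simp add: x_def)
  have "{j. u $ j > 0} \<noteq> {}"
    using \<open>u \<noteq> 0\<close> prox_nonneg[OF _ y u] \<nu> by (force simp: vec_eq_iff order_less_le)
  then have "1 \<le> card {j. u $ j > 0}" by (simp add: Suc_le_eq card_gt_0_iff)
  then have "\<nu> \<le> card {j. u $ j > 0} * \<nu>" using \<nu> by simp
  also have "\<dots> \<le> 4 * x ^ 3"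
    using prox_second_order[OF _ y u \<open>u \<noteq> 0\<close>] \<nu> by (simp add: x_def)
  also have "\<dots> \<le> (2 * x) ^ 3" using x by (simp add: power_mult_distrib)
  finally have "\<kappa> \<le> 2 * x"
    using \<kappa>(2) x power_le_imp_le_base[of \<kappa> 2 "2 * x"] by (simp add: numeral_3_eq_3)
  then have "\<kappa>\<^sup>2 * \<kappa> \<le> \<kappa>\<^sup>2 * (2 * x)" by (intro mult_left_mono) auto
  then have "\<nu> / (2 * x) \<le> \<kappa>\<^sup>2"
    using x \<kappa>(2) by (simp add: field_simps power2_eq_square power3_eq_cube)
  moreover have "y $ i > \<kappa>\<^sup>2" using large \<kappa>(3) zero_le_power2[of \<kappa>] by linarith
  ultimately show ?thesis
    using prox_first_order[OF _ y u \<open>u \<noteq> 0\<close>, of i] \<nu> by (simp add: x_def)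
qed

theorem corollary3p5:
  fixes \<nu> :: real and y :: "real ^ 'n::{finite,linorder}"
  assumes "\<nu> > 0"
    and "y \<in> nonneg_decreasing"
  shows "prox \<nu> y =
    (if norm1 y \<le> 3 / 2 powr (4/3) * \<nu> powr (2/3) then {0}
     else if y \<succ> (3/2 * \<nu> powr (2/3)) *\<^sub>R 1 then {y - c \<nu> y (Max UNIV) *\<^sub>R 1}
     else if infnorm y > 3/2 * \<nu> powr (2/3) \<and> \<not> y \<succ> (3/2 * \<nu> powr (2/3)) *\<^sub>R 1
       then argmin_on (J \<nu> y) (S_half \<nu> y)
     else argmin_on (J \<nu> y) ({0} \<union> S_half \<nu> y))"
proof -
  have y0: "\<And>i. 0 \<le> y $ i" using assms(2) by (auto simp: nonneg_decreasing_def)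
  have ne: "prox \<nu> y \<noteq> {}" using prox_nonempty[of \<nu>] assms(1) by simp
  note pos = prox_coordinate_pos[OF assms(1) y0]
  have case1: "prox \<nu> y = {0}" if "norm1 y \<le> 3 / 2 powr (4/3) * \<nu> powr (2/3)"
  proof (rule prox_eq_zero[OF assms(1)])
    have "(2::real) powr 1 < 2 powr (4/3)" by (intro powr_less_mono) auto
    then have "3 / 2 powr (4/3) < (3/2 :: real)" by (intro divide_strict_left_mono) auto
    then have "3 / 2 powr (4/3) * \<nu> powr (2/3) < 3/2 * \<nu> powr (2/3)"
      using assms(1) by (intro mult_strict_right_mono) auto
    then show "norm1 y < 3/2 * \<nu> powr (2/3)" using that by simp
  qed
  have case2: "prox \<nu> y = {y - c \<nu> y (Max UNIV) *\<^sub>R 1}" if "y \<succ> (3/2 * \<nu> powr (2/3)) *\<^sub>R 1"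
  proof -
    have "u = y - c \<nu> y (Max UNIV) *\<^sub>R 1" if u: "u \<in> prox \<nu> y" for u
    proof -
      have up: "u $ i > 0" for i
        using pos[OF u] \<open>y \<succ> _\<close> by (simp add: strictly_above_def)
      then have "u \<noteq> 0" by (metis less_irrefl zero_index)
      obtain s where s: "{i. u $ i > 0} = {..s}" "\<And>i. u $ i = max (y $ i - c \<nu> y s) 0"
        using prox_imp_S_half_form[OF assms u \<open>u \<noteq> 0\<close>] by metis
      have "Max UNIV \<in> {..s}" using up unfolding s(1)[symmetric] by simp
      then have "s = Max UNIV" by (simp add: antisym)
      moreover have "u $ i = y $ i - c \<nu> y s" for i
        using s(2)[of i] up[of i] by (auto simp: max_def split: if_splits)
      ultimately show ?thesis by (simp add: vec_eq_iff)
    qed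
    then show ?thesis using ne by blast
  qed
  have case3: "argmin_on (J \<nu> y) (S_half \<nu> y) = prox \<nu> y" if "infnorm y > 3/2 * \<nu> powr (2/3)"
  proof (rule argmin_on_eq_prox[OF _ ne])
    define A where "A = {\<bar>y $ i\<bar> | i. i \<in> UNIV}"
    have A: "finite A" "A \<noteq> {}" by (auto simp: A_def full_SetCompr_eq)
    have "infnorm y = Max A" unfolding infnorm_cart A_def[symmetric] using A by (rule cSup_eq_Max)
    then have "infnorm y \<in> A" using Max_in[OF A] by simp
    then obtain i where "infnorm y = y $ i" using y0 by (auto simp: A_def)
    then have "0 \<notin> prox \<nu> y" using pos[of 0 i] that by auto
    then show "prox \<nu> y \<subseteq> S_half \<nu> y" using prox_subset_S_half[OF assms] by blast
  qed
  have case4: "argmin_on (J \<nu> y) ({0} \<union> S_half \<nu> y) = prox \<nu> y"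
    by (rule argmin_on_eq_prox[OF prox_subset_S_half[OF assms] ne])
  show ?thesis using case1 case2 case3 case4 by auto
qed

end
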